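(* Let $M_1, \ldots, M_n$ be independent copies of a $d$ by $d$ positive semi-definite symmetric random matrix $M$ with mean $\mathbf{E} M = \Sigma$, where $\Sigma \neq 0$. Suppose that for some $\kappa \ge 1$, \[ \|x^{\top} M x\|_{\psi_1} \le \kappa^2\, x^{\top}\Sigma x \quad \text{for all } x \in \mathbb{R}^d . \] Then, for any $t > 0$, with probability at least $1 - \exp(-t)$, it holds that \[ \left\|\frac{1}{n}\sum_{i = 1}^n M_i - \Sigma\right\| \le 20\kappa^2\|\Sigma\|\sqrt{\frac{4\mathbf{r}(\Sigma) + t}{n}}, \] whenever $n \ge 4\mathbf{r}(\Sigma)+t$.
   Context: $\|\cdot\|$ denotes the operator norm of a matrix. For a random variable $Y$ and $\alpha\in[1,2]$, $\|Y\|_{\psi_\alpha} = \inf\{c > 0: \mathbf{E}\exp(|Y|^\alpha/c^{\alpha}) \le 2\}$; here $\alpha = 1$. For a nonzero positive semi-definite matrix $\Sigma$, the effective rank is $\mathbf{r}(\Sigma) = \operatorname{Tr}(\Sigma)/\|\Sigma\|$. *)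

theory Defs
  imports "HOL-Probability.Probability"
begin

definition pos_semidef :: "real^'d^'d \<Rightarrow> bool" where
  "pos_semidef A \<longleftrightarrow> transpose A = A \<and> (\<forall>x. 0 \<le> x \<bullet> (A *v x))"

text \<open>The expectation is the nonnegative Lebesgue integral and the norm takes values in
  \<^typ>\<open>ennreal\<close>, so that a non-integrable exponential moment counts as infinite and the
  infimum of the empty set is \<^term>\<open>top :: ennreal\<close>.\<close>

definition psi_norm :: "real \<Rightarrow> 'a measure \<Rightarrow> ('a \<Rightarrow> real) \<Rightarrow> ennreal" where
  "psi_norm \<alpha> P Y =
     (INF c \<in> {c::real. c > 0 \<and>
        (\<integral>\<^sup>+\<omega>. ennreal (exp (\<bar>Y \<omega>\<bar> powr \<alpha> / c powr \<alpha>)) \<partial>P) \<le> 2}. ennreal c)"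

definition effective_rank :: "real^'d^'d \<Rightarrow> real" where
  "effective_rank A = trace A / onorm ((*v) A)"

end

theory Submission
  imports Defs
begin

text \<open>
  The proof is a Gaussian smoothing (PAC-Bayesian) argument. Let \<open>A\<close> be the sample mean
  minus \<open>\<Sigma>\<close> and \<open>N = l n A\<close> with a scalar \<open>l > 0\<close>. For a fixed direction \<open>\<theta>\<close> with
  \<open>\<theta>\<^sup>T \<Sigma> \<theta> \<le> 5/2 \<parallel>\<Sigma>\<parallel>\<close>, the sub-exponential hypothesis bounds the exponential moments of
  \<open>\<plusminus>\<theta>\<^sup>T N \<theta>\<close> (lemma \<open>mgf_le_of_psi_norm_less\<close> and independence). Integrating these bounds over
  such \<open>\<theta>\<close> against a centred Gaussian measure \<open>\<gamma>\<close> with covariance \<open>\<sigma>\<^sup>2 I\<close> and applying Markov's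
  inequality once gives a single event of probability at least \<open>1 - exp (- t)\<close> on which the two
  integrals of \<open>exp (\<plusminus>\<theta>\<^sup>T N \<theta>)\<close> are at most some constant \<open>c\<close>.

  On this event all directions are controlled simultaneously. Shifting \<open>\<gamma>\<close> by a vector \<open>u\<close> of norm
  at most 1 costs a density factor, whose part odd in the integration variable disappears on
  averaging over \<open>z\<close> and \<open>-z\<close>; this gives
  \<open>exp (\<plusminus>u\<^sup>T N u - \<parallel>u\<parallel>\<^sup>2 / (2\<sigma>\<^sup>2)) V\<^sub>\<plusminus> \<le> c\<close>, where \<open>V\<^sub>\<plusminus>\<close> is the integral of \<open>exp (\<plusminus>z\<^sup>T N z)\<close> over
  the symmetric set \<open>{z. z\<^sup>T \<Sigma> z \<le> \<parallel>\<Sigma>\<parallel> / 4}\<close> and does not depend on \<open>u\<close>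
  (lemma \<open>gauss_shift_lower_bound\<close>).
  For unit vectors \<open>x\<close> and \<open>y\<close> put \<open>u = (x + y) / 2\<close> and \<open>v = (x - y) / 2\<close>. Multiplying the bound with
  sign \<open>+\<close> at \<open>u\<close> by the bound with sign \<open>-\<close> at \<open>v\<close>, polarization turns the exponent into
  \<open>x\<^sup>T N y - 1 / (2\<sigma>\<^sup>2)\<close>, and by Cauchy-Schwarz the remaining factor \<open>V\<^sub>+ V\<^sub>-\<close> is at least the square of
  the Gaussian measure of the symmetric set (lemma \<open>onorm_le_of_gauss_exp_integrals\<close>).

  The effective rank enters through the choice \<open>\<sigma>\<^sup>2 = 1 / (8 r)\<close>: the mean of \<open>z\<^sup>T \<Sigma> z\<close> under \<open>\<gamma>\<close> is
  \<open>\<sigma>\<^sup>2 Tr \<Sigma> = \<parallel>\<Sigma>\<parallel> / 8\<close>, so that the symmetric set has measure at least 1/2, while the price of the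
  shifts is only \<open>1 / (2\<sigma>\<^sup>2) = 4 r\<close>.
\<close>

section \<open>Isotropic Gaussian measures\<close>

text \<open>The centred Gaussian measure with covariance \<open>\<sigma>\<^sup>2 I\<close>, as the product of its one-dimensional
  densities over the standard basis; a probability measure for \<open>\<sigma> > 0\<close>.\<close>

definition gauss :: "real \<Rightarrow> 'a::euclidean_space measure" where
  "gauss \<sigma> = density lborel (\<lambda>z. ennreal (\<Prod>b\<in>Basis. normal_density 0 \<sigma> (z \<bullet> b)))"

lemma sets_gauss [simp, measurable_cong]: "sets (gauss \<sigma>) = sets borel"
  and space_gauss [simp]: "space (gauss \<sigma>) = UNIV"
  by (simp_all add: gauss_def)

lemma prob_space_gauss:
  assumes "\<sigma> > 0"
  shows "prob_space (gauss \<sigma> :: 'a::euclidean_space measure)"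
proof
  have "emeasure (gauss \<sigma> :: 'a measure) (space (gauss \<sigma>))
      = (\<integral>\<^sup>+z. (\<Prod>b\<in>Basis. ennreal (normal_density 0 \<sigma> ((z::'a) \<bullet> b))) \<partial>lborel)"
    by (simp add: gauss_def emeasure_density prod_ennreal)
  also have "\<dots> = (\<Prod>b\<in>(Basis::'a set). \<integral>\<^sup>+x. ennreal (normal_density 0 \<sigma> x) \<partial>lborel)"
    by (rule nn_integral_lborel_prod) auto
  also have "\<dots> = 1"
    using assms by (simp add: nn_integral_eq_integral)
  finally show "emeasure (gauss \<sigma> :: 'a measure) (space (gauss \<sigma>)) = 1" .
qed

lemma prod_normal_density:
  fixes z :: "'a::euclidean_space"
  shows "(\<Prod>b\<in>Basis. normal_density 0 \<sigma> (z \<bullet> b))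
    = (1 / sqrt (2 * pi * \<sigma>\<^sup>2)) ^ DIM('a) * exp (- (z \<bullet> z) / (2 * \<sigma>\<^sup>2))"
proof -
  have "(\<Sum>b\<in>Basis. - (z \<bullet> b)\<^sup>2 / (2 * \<sigma>\<^sup>2)) = - (z \<bullet> z) / (2 * \<sigma>\<^sup>2)"
    by (simp add: euclidean_inner[of z z] sum_negf power2_eq_square flip: sum_divide_distrib)
  then show ?thesis
    by (simp add: normal_density_def prod.distrib power_divide prod_dividef flip: exp_sum)
qed

text \<open>Translating a centred Gaussian by \<open>u\<close> multiplies it by the Cameron-Martin density.\<close>

lemma nn_integral_gauss_shift:
  fixes f :: "'a::euclidean_space \<Rightarrow> ennreal"
  assumes [measurable]: "f \<in> borel_measurable borel"
  shows "(\<integral>\<^sup>+\<theta>. f \<theta> \<partial>gauss \<sigma>)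
    = (\<integral>\<^sup>+z. f (u + z) * ennreal (exp (- (2 * (u \<bullet> z) + u \<bullet> u) / (2 * \<sigma>\<^sup>2))) \<partial>gauss \<sigma>)"
proof -
  define c where "c = (1 / sqrt (2 * pi * \<sigma>\<^sup>2)) ^ DIM('a)"
  have c: "0 \<le> c" by (simp add: c_def)
  have dens: "c * exp (- ((u + z) \<bullet> (u + z)) / (2 * \<sigma>\<^sup>2))
      = c * exp (- (z \<bullet> z) / (2 * \<sigma>\<^sup>2)) * exp (- (2 * (u \<bullet> z) + u \<bullet> u) / (2 * \<sigma>\<^sup>2))" for z
    by (simp add: inner_add inner_commute[of z u] diff_divide_distrib add_divide_distrib
          flip: exp_add)
  have "(\<integral>\<^sup>+\<theta>. f \<theta> \<partial>gauss \<sigma>)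
      = (\<integral>\<^sup>+\<theta>. ennreal (c * exp (- (\<theta> \<bullet> \<theta>) / (2 * \<sigma>\<^sup>2))) * f \<theta> \<partial>distr lborel borel ((+) u))"
    by (simp add: gauss_def nn_integral_density prod_normal_density c_def lborel_distr_plus)
  also have "\<dots> = (\<integral>\<^sup>+z. ennreal (c * exp (- ((u + z) \<bullet> (u + z)) / (2 * \<sigma>\<^sup>2))) * f (u + z) \<partial>lborel)"
    by (rule nn_integral_distr) auto
  also have "\<dots> = (\<integral>\<^sup>+z. ennreal (c * exp (- (z \<bullet> z) / (2 * \<sigma>\<^sup>2))) *
      (f (u + z) * ennreal (exp (- (2 * (u \<bullet> z) + u \<bullet> u) / (2 * \<sigma>\<^sup>2)))) \<partial>lborel)"
    unfolding dens using c by (intro nn_integral_cong) (simp add: ennreal_mult mult_ac)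
  also have "\<dots> = (\<integral>\<^sup>+z. f (u + z) * ennreal (exp (- (2 * (u \<bullet> z) + u \<bullet> u) / (2 * \<sigma>\<^sup>2))) \<partial>gauss \<sigma>)"
    by (simp add: gauss_def nn_integral_density prod_normal_density c_def)
  finally show ?thesis .
qed

lemma lborel_distr_uminus_euclidean:
  "distr lborel borel uminus = (lborel :: 'a::euclidean_space measure)"
proof -
  have "lborel = density (distr lborel borel (\<lambda>x::'a. 0 + (-1) *\<^sub>R x)) (\<lambda>_. ennreal (\<bar>-1::real\<bar> ^ DIM('a)))"
    by (rule lborel_affine) simp
  then show ?thesis by (simp add: density_1)
qed

lemma nn_integral_gauss_uminus:
  fixes f :: "'a::euclidean_space \<Rightarrow> ennreal"
  assumes [measurable]: "f \<in> borel_measurable borel"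
  shows "(\<integral>\<^sup>+z. f (- z) \<partial>gauss \<sigma>) = (\<integral>\<^sup>+z. f z \<partial>gauss \<sigma>)"
proof -
  define g where "g z = ennreal (\<Prod>b\<in>Basis. normal_density 0 \<sigma> (z \<bullet> b))" for z :: 'a
  have [measurable]: "g \<in> borel_measurable borel" by (simp add: g_def[abs_def])
  have even: "g (- z) = g z" for z by (simp add: g_def normal_density_def)
  have "(\<integral>\<^sup>+z. f z \<partial>gauss \<sigma>) = (\<integral>\<^sup>+z. g z * f z \<partial>distr lborel borel uminus)"
    by (simp add: gauss_def nn_integral_density lborel_distr_uminus_euclidean g_def)
  also have "\<dots> = (\<integral>\<^sup>+z. g (- z) * f (- z) \<partial>lborel)"
    by (rule nn_integral_distr) auto
  also have "\<dots> = (\<integral>\<^sup>+z. f (- z) \<partial>gauss \<sigma>)"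
    using even by (simp add: gauss_def nn_integral_density flip: g_def)
  finally show ?thesis by simp
qed

lemma has_bochner_integral_lborel_prod:
  fixes f :: "'a::euclidean_space \<Rightarrow> real \<Rightarrow> real"
  assumes "\<And>b. b \<in> Basis \<Longrightarrow> integrable lborel (f b)"
  shows "has_bochner_integral lborel (\<lambda>x. \<Prod>b\<in>Basis. f b (x \<bullet> b))
    (\<Prod>b\<in>Basis. \<integral>x. f b x \<partial>lborel)"
proof -
  interpret product_sigma_finite "\<lambda>_::'a. lborel :: real measure" ..
  have [measurable]: "f b \<in> borel_measurable borel" if "b \<in> Basis" for b
    using assms[OF that] by auto
  have eq: "(\<Prod>b\<in>Basis. f b ((\<Sum>b\<in>Basis. x b *\<^sub>R b) \<bullet> b)) = (\<Prod>b\<in>Basis. f b (x b))" for x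
    by (intro prod.cong) auto
  have "integrable (\<Pi>\<^sub>M b\<in>Basis. lborel) (\<lambda>x. \<Prod>b\<in>Basis. f b (x b))"
    by (rule product_integrable_prod) (use assms in auto)
  moreover have "(\<integral>x. (\<Prod>b\<in>Basis. f b (x b)) \<partial>(\<Pi>\<^sub>M b\<in>Basis. lborel)) = (\<Prod>b\<in>Basis. \<integral>x. f b x \<partial>lborel)"
    by (rule product_integral_prod) (use assms in auto)
  ultimately show ?thesis
    by (subst lborel_eq) (simp add: has_bochner_integral_iff integrable_distr_eq integral_distr eq)
qed

lemma gauss_second_moment:
  fixes b c :: "'a::euclidean_space"
  assumes "\<sigma> > 0" "b \<in> Basis" "c \<in> Basis"
  shows "has_bochner_integral (gauss \<sigma>) (\<lambda>z. (z \<bullet> b) * (z \<bullet> c)) (if b = c then \<sigma>\<^sup>2 else 0)"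
proof -
  let ?n = "normal_density 0 \<sigma>"
  \<comment> \<open>The integrand is a product over coordinates, with \<open>k e\<close> the power of coordinate \<open>e\<close>.\<close>
  define k :: "'a \<Rightarrow> nat" where "k e = of_bool (e = b) + of_bool (e = c)" for e
  have moments: "has_bochner_integral lborel (\<lambda>x. ?n x * x ^ j)
      (if j = 0 then 1 else if j = 1 then 0 else \<sigma>\<^sup>2)" if "j \<le> 2" for j
  proof -
    from that have "j = 0 \<or> j = 1 \<or> j = 2" by arith
    then consider "j = 0" | "j = 1" | "j = 2" by blast
    then show ?thesis
    proof cases
      case 1
      then show ?thesis using assms(1) normal_moment_even[of \<sigma> 0 0] by simp
    next
      case 2
      then show ?thesis using assms(1) normal_moment_odd[of \<sigma> 0 0] by simp
    next
      case 3
      then show ?thesis using assms(1) normal_moment_even[of \<sigma> 0 1] by simp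
    qed
  qed
  have k2: "k e \<le> 2" for e by (simp add: k_def)
  have "has_bochner_integral lborel (\<lambda>z. \<Prod>e\<in>Basis. ?n (z \<bullet> e) * (z \<bullet> e) ^ k e)
    (\<Prod>e\<in>Basis. \<integral>x. ?n x * x ^ k e \<partial>lborel)"
    by (rule has_bochner_integral_lborel_prod)
       (use moments[OF k2] in \<open>auto simp: has_bochner_integral_iff\<close>)
  moreover have "(\<Prod>e\<in>Basis. \<integral>x. ?n x * x ^ k e \<partial>lborel) = (if b = c then \<sigma>\<^sup>2 else 0)"
  proof (cases "b = c")
    case True
    have "(\<Prod>e\<in>Basis. \<integral>x. ?n x * x ^ k e \<partial>lborel) = (\<Prod>e\<in>Basis. if e = b then \<sigma>\<^sup>2 else 1)"
      using True by (intro prod.cong refl, subst has_bochner_integral_integral_eq[OF moments[OF k2]])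
        (auto simp: k_def)
    then show ?thesis using True assms(2) by simp
  next
    case False
    have "(\<integral>x. ?n x * x ^ k b \<partial>lborel) = 0"
      using False by (subst has_bochner_integral_integral_eq[OF moments[OF k2]]) (auto simp: k_def)
    then show ?thesis using False assms(2) by (auto intro!: prod_zero)
  qed
  moreover have "(\<Prod>e\<in>Basis. ?n (z \<bullet> e) * (z \<bullet> e) ^ k e)
      = (\<Prod>e\<in>Basis. ?n (z \<bullet> e)) *\<^sub>R ((z \<bullet> b) * (z \<bullet> c))" for z
  proof -
    have "(\<Prod>e\<in>Basis. (z \<bullet> e) ^ k e)
        = (\<Prod>e\<in>Basis. if e = b then z \<bullet> b else 1) * (\<Prod>e\<in>Basis. if e = c then z \<bullet> c else 1)"
      unfolding prod.distrib[symmetric] by (intro prod.cong refl) (auto simp: k_def power2_eq_square)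
    then show ?thesis using assms(2,3) by (simp add: prod.distrib)
  qed
  ultimately show ?thesis
    unfolding gauss_def by (intro has_bochner_integral_density) (auto intro!: prod_nonneg)
qed

text \<open>The smoothing step. After the shift by \<open>u\<close>, the integrand at \<open>z\<close> is replaced by its average over
  \<open>z\<close> and \<open>-z\<close>; the arithmetic-geometric mean inequality removes the cross terms and leaves the
  factor depending on \<open>u\<close> outside of an integral that does not depend on it. The function \<open>q\<close> is
  only used through the parallelogram identity and evenness.\<close>

lemma gauss_shift_lower_bound:
  fixes q :: "'a::euclidean_space \<Rightarrow> real" and u :: 'a
  assumes [measurable]: "q \<in> borel_measurable borel" "S \<in> sets borel" "K \<in> sets borel"
    and quad: "\<And>z. q (u + z) + q (u - z) = 2 * q u + 2 * q z"
    and even: "\<And>z. q (- z) = q z"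
    and sym: "\<And>z. z \<in> K \<Longrightarrow> - z \<in> K"
    and sub: "\<And>z. z \<in> K \<Longrightarrow> u + z \<in> S"
  shows "ennreal (exp (q u - (norm u)\<^sup>2 / (2 * \<sigma>\<^sup>2))) * (\<integral>\<^sup>+z. ennreal (exp (q z)) * indicator K z \<partial>gauss \<sigma>)
    \<le> (\<integral>\<^sup>+\<theta>. ennreal (exp (q \<theta>)) * indicator S \<theta> \<partial>gauss \<sigma>)" (is "?L \<le> ?R")
proof -
  \<comment> \<open>\<open>G\<close> is the exponent after the shift; \<open>J\<close> is its exponential integral over \<open>K\<close>.\<close>
  define G where "G z = q (u + z) - (2 * (u \<bullet> z) + u \<bullet> u) / (2 * \<sigma>\<^sup>2)" for z
  have [measurable]: "G \<in> borel_measurable borel" unfolding G_def by measurable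
  define J where "J = (\<integral>\<^sup>+z. ennreal (exp (G z)) * indicator K z \<partial>gauss \<sigma>)"
  have "?R = (\<integral>\<^sup>+z. ennreal (exp (q (u + z))) * indicator S (u + z) *
      ennreal (exp (- (2 * (u \<bullet> z) + u \<bullet> u) / (2 * \<sigma>\<^sup>2))) \<partial>gauss \<sigma>)"
    by (rule nn_integral_gauss_shift) measurable
  also have "\<dots> = (\<integral>\<^sup>+z. ennreal (exp (G z)) * indicator S (u + z) \<partial>gauss \<sigma>)"
    by (intro nn_integral_cong)
       (auto simp: G_def diff_divide_distrib add_divide_distrib indicator_def simp flip: ennreal_mult exp_add)
  also have "\<dots> \<ge> J" unfolding J_def
    by (intro nn_integral_mono) (auto simp: sub indicator_def)
  finally have JR: "J \<le> ?R" .
  have J': "J = (\<integral>\<^sup>+z. ennreal (exp (G (- z))) * indicator K z \<partial>gauss \<sigma>)"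
  proof -
    have "indicator K (- z) = (indicator K z :: ennreal)" for z
      using sym[of z] sym[of "- z"] by (auto simp: indicator_def)
    then show ?thesis unfolding J_def by (subst nn_integral_gauss_uminus[symmetric]) auto
  qed
  have mid: "2 * (exp (q u - (norm u)\<^sup>2 / (2 * \<sigma>\<^sup>2)) * exp (q z)) \<le> exp (G z) + exp (G (- z))" for z
  proof -
    have eq: "(G z + G (- z)) / 2 = q u - (norm u)\<^sup>2 / (2 * \<sigma>\<^sup>2) + q z"
      using quad[of z] by (simp add: G_def power2_norm_eq_inner diff_divide_distrib add_divide_distrib)
    have sq: "(exp (a / 2))\<^sup>2 = exp a" for a :: real by (simp flip: exp_double)
    have "0 \<le> (exp (G z / 2) - exp (G (- z) / 2))\<^sup>2" by simp
    then have "2 * exp ((G z + G (- z)) / 2) \<le> exp (G z) + exp (G (- z))"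
      unfolding power2_diff sq add_divide_distrib exp_add by linarith
    then show ?thesis unfolding eq exp_add .
  qed
  define e where "e = exp (q u - (norm u)\<^sup>2 / (2 * \<sigma>\<^sup>2))"
  have e: "0 \<le> e" by (simp add: e_def)
  have "2 * ?L = ennreal (2 * e) * (\<integral>\<^sup>+z. ennreal (exp (q z)) * indicator K z \<partial>gauss \<sigma>)"
    using e by (simp add: e_def ennreal_mult mult.assoc)
  also have "\<dots> = (\<integral>\<^sup>+z. ennreal (2 * e) * (ennreal (exp (q z)) * indicator K z) \<partial>gauss \<sigma>)"
    by (rule nn_integral_cmult[symmetric]) measurable
  also have "\<dots> = (\<integral>\<^sup>+z. ennreal (2 * (e * exp (q z))) * indicator K z \<partial>gauss \<sigma>)"
    using e by (intro nn_integral_cong) (simp add: ennreal_mult mult.assoc)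
  also have "\<dots> \<le> (\<integral>\<^sup>+z. ennreal (exp (G z) + exp (G (- z))) * indicator K z \<partial>gauss \<sigma>)"
    using mid[folded e_def] by (intro nn_integral_mono mult_right_mono ennreal_leI) auto
  also have "\<dots> = J + J"
  proof -
    have "J + J = (\<integral>\<^sup>+z. ennreal (exp (G z)) * indicator K z + ennreal (exp (G (- z))) * indicator K z \<partial>gauss \<sigma>)"
      by (subst (2) J', unfold J_def, rule nn_integral_add[symmetric]) measurable
    then show ?thesis by (simp add: distrib_right)
  qed
  finally have "2 * ?L \<le> 2 * J" unfolding mult_2[of J] .
  then have "?L \<le> J" by (subst (asm) ennreal_mult_le_mult_iff) auto
  with JR show ?thesis by simp
qed

lemma emeasure_square_le_exp_integrals:
  fixes q :: "'a \<Rightarrow> real"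
  assumes [measurable]: "q \<in> borel_measurable M" "K \<in> sets M"
  shows "(emeasure M K)\<^sup>2 \<le> (\<integral>\<^sup>+z. ennreal (exp (q z)) * indicator K z \<partial>M) *
    (\<integral>\<^sup>+z. ennreal (exp (- q z)) * indicator K z \<partial>M)"
proof -
  let ?f = "\<lambda>s z. ennreal (exp (s * q z / 2)) * indicator K z"
  have "(\<integral>\<^sup>+z. ?f 1 z * ?f (-1) z \<partial>M)\<^sup>2 \<le> (\<integral>\<^sup>+z. (?f 1 z)\<^sup>2 \<partial>M) * (\<integral>\<^sup>+z. (?f (-1) z)\<^sup>2 \<partial>M)"
    by (rule Cauchy_Schwarz_nn_integral) measurable
  moreover have "?f 1 z * ?f (-1) z = indicator K z" for z
    by (auto simp: indicator_def simp flip: ennreal_mult exp_add)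
  moreover have "(?f 1 z)\<^sup>2 = ennreal (exp (q z)) * indicator K z"
    "(?f (-1) z)\<^sup>2 = ennreal (exp (- q z)) * indicator K z" for z
    by (auto simp: indicator_def ennreal_power simp flip: exp_double)
  ultimately show ?thesis using assms(2) by (simp only: nn_integral_indicator)
qed

section \<open>Exponential moments of sub-exponential variables\<close>

text \<open>All Taylor terms of \<open>exp y\<close> from the second order on are at most \<open>q\<^sup>2\<close>
  times those of \<open>exp u\<close>.\<close>

lemma exp_le_linear_plus_scaled_exp:
  fixes y q u :: real
  assumes "\<bar>y\<bar> = q * u" "0 \<le> q" "q \<le> 1" "0 \<le> u"
  shows "exp y \<le> 1 + y + q\<^sup>2 * (exp u - 1)"
proof -
  let ?t = "\<lambda>v n. inverse (fact (n + 2)) *\<^sub>R (v ^ (n + 2) :: real)"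
  have sm: "summable (?t v)" for v
    using summable_ignore_initial_segment[OF summable_exp_generic[of v], of 2] by simp
  have "(\<Sum>n. ?t y n) \<le> (\<Sum>n. q\<^sup>2 * ?t u n)"
  proof (intro suminf_le summable_mult sm)
    fix n
    have "y ^ (n + 2) \<le> \<bar>y\<bar> ^ (n + 2)"
      by (metis abs_ge_self power_abs)
    also have "\<dots> = q ^ (n + 2) * u ^ (n + 2)"
      by (simp only: assms(1) power_mult_distrib)
    also have "\<dots> \<le> q\<^sup>2 * u ^ (n + 2)"
      using assms by (intro mult_right_mono power_decreasing) auto
    finally have "?t y n \<le> inverse (fact (n + 2)) *\<^sub>R (q\<^sup>2 * u ^ (n + 2))"
      by (intro scaleR_left_mono) auto
    then show "?t y n \<le> q\<^sup>2 * ?t u n" by (simp add: mult_ac)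
  qed
  also have "\<dots> = q\<^sup>2 * (exp u - 1 - u)"
    using exp_first_two_terms[of u] by (subst suminf_mult[OF sm]) simp
  also have "\<dots> \<le> q\<^sup>2 * (exp u - 1)"
    using assms by (intro mult_left_mono) auto
  finally show ?thesis using exp_first_two_terms[of y] by simp
qed

text \<open>A Bernstein-type bound on the moment generating function. The strict inequality on the
  \<open>\<psi>\<^sub>1\<close> norm avoids the question whether the infimum defining it is attained.\<close>

lemma (in prob_space) mgf_le_of_psi_norm_less:
  assumes Y: "has_bochner_integral M Y s"
    and psi: "psi_norm 1 M Y < ennreal K"
    and lK: "\<bar>l\<bar> * K \<le> 1"
  shows "(\<integral>\<^sup>+\<omega>. ennreal (exp (l * (Y \<omega> - s))) \<partial>M) \<le> ennreal (exp ((l * K)\<^sup>2))"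
proof -
  from psi obtain c where c: "0 < c" "c < K"
    and Ec: "(\<integral>\<^sup>+\<omega>. ennreal (exp (\<bar>Y \<omega>\<bar> powr 1 / c powr 1)) \<partial>M) \<le> 2"
    unfolding psi_norm_def INF_less_iff by (auto simp: ennreal_less_iff)
  have [measurable]: "Y \<in> borel_measurable M" using Y by (auto simp: has_bochner_integral_iff)
  define q where "q = \<bar>l\<bar> * K"
  define E where "E \<omega> = exp (\<bar>Y \<omega>\<bar> / K)" for \<omega>
  have [measurable]: "E \<in> borel_measurable M" unfolding E_def by measurable
  have q: "0 \<le> q" "q \<le> 1" "q\<^sup>2 = (l * K)\<^sup>2"
    using c lK by (auto simp: q_def power_mult_distrib)
  have E2: "(\<integral>\<^sup>+\<omega>. ennreal (E \<omega>) \<partial>M) \<le> ennreal 2"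
  proof -
    have "(\<integral>\<^sup>+\<omega>. ennreal (E \<omega>) \<partial>M) \<le> (\<integral>\<^sup>+\<omega>. ennreal (exp (\<bar>Y \<omega>\<bar> powr 1 / c powr 1)) \<partial>M)"
      unfolding E_def using c by (intro nn_integral_mono ennreal_leI) (auto intro!: divide_left_mono)
    with Ec show ?thesis by simp
  qed
  have intE: "integrable M E"
    by (rule integrableI_bounded) (use E2 in \<open>auto simp: E_def less_top[symmetric] top_unique\<close>)
  have EE: "expectation E \<le> 2"
    using E2 by (subst (asm) nn_integral_eq_integral[OF intE]) (auto simp: E_def simp del: ennreal_numeral)
  have intY: "integrable M Y" and EY: "expectation Y = s"
    using Y by (auto simp: has_bochner_integral_iff)
  let ?B = "\<lambda>\<omega>. 1 + l * Y \<omega> + q\<^sup>2 * (E \<omega> - 1)"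
  have le: "exp (l * Y \<omega>) \<le> ?B \<omega>" for \<omega>
    unfolding E_def by (rule exp_le_linear_plus_scaled_exp) (use c q in \<open>auto simp: q_def abs_mult\<close>)
  have B0: "0 \<le> ?B \<omega>" for \<omega> using le[of \<omega>] exp_gt_zero[of "l * Y \<omega>"] by linarith
  have "(\<integral>\<^sup>+\<omega>. ennreal (exp (l * Y \<omega>)) \<partial>M) \<le> (\<integral>\<^sup>+\<omega>. ennreal (?B \<omega>) \<partial>M)"
    by (intro nn_integral_mono ennreal_leI le)
  also have "\<dots> = ennreal (expectation ?B)"
    by (rule nn_integral_eq_integral) (use intE intY B0 in auto)
  also have "expectation ?B = 1 + l * s + q\<^sup>2 * (expectation E - 1)"
    using intE intY EY by (simp add: prob_space)
  also have "ennreal \<dots> \<le> ennreal (exp (l * s + q\<^sup>2))"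
  proof (rule ennreal_leI)
    have "q\<^sup>2 * (expectation E - 1) \<le> q\<^sup>2 * 1" using EE by (intro mult_left_mono) auto
    with exp_ge_add_one_self[of "l * s + q\<^sup>2"]
    show "1 + l * s + q\<^sup>2 * (expectation E - 1) \<le> exp (l * s + q\<^sup>2)" by linarith
  qed
  finally have main: "(\<integral>\<^sup>+\<omega>. ennreal (exp (l * Y \<omega>)) \<partial>M) \<le> ennreal (exp (l * s + q\<^sup>2))" .
  have "(\<integral>\<^sup>+\<omega>. ennreal (exp (l * (Y \<omega> - s))) \<partial>M)
      = (\<integral>\<^sup>+\<omega>. ennreal (exp (- (l * s))) * ennreal (exp (l * Y \<omega>)) \<partial>M)"
    by (intro nn_integral_cong) (simp add: right_diff_distrib flip: ennreal_mult exp_add)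
  also have "\<dots> = ennreal (exp (- (l * s))) * (\<integral>\<^sup>+\<omega>. ennreal (exp (l * Y \<omega>)) \<partial>M)"
    by (rule nn_integral_cmult) measurable
  also have "\<dots> \<le> ennreal (exp (- (l * s))) * ennreal (exp (l * s + q\<^sup>2))"
    by (intro mult_left_mono main) auto
  also have "\<dots> = ennreal (exp ((l * K)\<^sup>2))"
    by (simp add: q(3) flip: ennreal_mult exp_add)
  finally show ?thesis .
qed

lemma (in prob_space) nn_integral_exp_sum_indep_le:
  fixes b :: real
  assumes "finite I" and indep: "indep_vars (\<lambda>_. borel) X I"
    and f [measurable]: "f \<in> borel_measurable borel"
    and b: "\<And>i. i \<in> I \<Longrightarrow> (\<integral>\<^sup>+\<omega>. ennreal (exp (f (X i \<omega>))) \<partial>M) \<le> ennreal (exp b)"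
  shows "(\<integral>\<^sup>+\<omega>. ennreal (exp (\<Sum>i\<in>I. f (X i \<omega>))) \<partial>M) \<le> ennreal (exp (card I * b))"
proof -
  have "(\<integral>\<^sup>+\<omega>. ennreal (exp (\<Sum>i\<in>I. f (X i \<omega>))) \<partial>M)
      = (\<integral>\<^sup>+\<omega>. (\<Prod>i\<in>I. ennreal (exp (f (X i \<omega>)))) \<partial>M)"
    using assms(1) by (simp add: exp_sum prod_ennreal)
  also have "\<dots> = (\<Prod>i\<in>I. \<integral>\<^sup>+\<omega>. ennreal (exp (f (X i \<omega>))) \<partial>M)"
    using assms(1) by (intro indep_vars_nn_integral indep_vars_compose2[OF indep]) auto
  also have "\<dots> \<le> (\<Prod>i\<in>I. ennreal (exp b))"
    by (intro prod_mono_ennreal b)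
  also have "\<dots> = ennreal (exp (card I * b))"
    by (simp add: ennreal_power exp_of_nat_mult)
  finally show ?thesis .
qed

section \<open>Quadratic forms and the operator norm\<close>

text \<open>The quadratic form \<open>x\<^sup>T A x\<close>; the matrix need not be symmetric.\<close>

definition quad_form :: "real^'d^'d \<Rightarrow> real^'d \<Rightarrow> real" where
  "quad_form A x = x \<bullet> (A *v x)"

lemma quad_form_eq_sum: "quad_form A x = (\<Sum>i\<in>UNIV. \<Sum>j\<in>UNIV. A $ i $ j * (x $ i * x $ j))"
  by (simp add: quad_form_def inner_vec_def matrix_vector_mult_def sum_distrib_left mult_ac)

lemma quad_form_measurable [measurable]:
  assumes [measurable]: "f \<in> borel_measurable M" "g \<in> borel_measurable M"
  shows "(\<lambda>x. quad_form (f x) (g x :: real^'d)) \<in> borel_measurable M"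
proof -
  have "continuous_on UNIV (\<lambda>p::(real^'d^'d) \<times> (real^'d). quad_form (fst p) (snd p))"
    unfolding quad_form_eq_sum by (intro continuous_intros)
  then have "(\<lambda>p::(real^'d^'d) \<times> (real^'d). quad_form (fst p) (snd p)) \<in> borel_measurable borel"
    by (rule borel_measurable_continuous_onI)
  then have "(\<lambda>x. (\<lambda>p. quad_form (fst p) (snd p)) (f x, g x)) \<in> borel_measurable M"
    by (rule measurable_compose[rotated]) (simp add: borel_prod[symmetric])
  then show ?thesis by simp
qed

lemma linear_quad_form: "linear (\<lambda>A. quad_form A x)"
  by (rule linearI)
     (simp_all add: quad_form_def matrix_vector_mult_add_rdistrib inner_add scaleR_matrix_vector_assoc[symmetric])

lemma quad_form_scaleR: "quad_form (c *\<^sub>R A) x = c * quad_form A x"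
  using linear_scale[OF linear_quad_form] by auto

lemma quad_form_diff: "quad_form (A - B) x = quad_form A x - quad_form B x"
  using linear_diff[OF linear_quad_form] .

lemma quad_form_sum: "quad_form (\<Sum>i\<in>I. A i) x = (\<Sum>i\<in>I. quad_form (A i) x)"
  using linear_sum[OF linear_quad_form] .

lemma quad_form_uminus [simp]: "quad_form A (- x) = quad_form A x"
  by (simp add: quad_form_eq_sum)

lemma quad_form_parallelogram:
  "quad_form A (x + y) + quad_form A (x - y) = 2 * quad_form A x + 2 * quad_form A y"
  by (simp add: quad_form_def inner_add inner_diff matrix_vector_mult_diff_distrib
        matrix_vector_right_distrib)

lemma inner_matrix_commute:
  assumes "transpose A = A"
  shows "x \<bullet> (A *v y) = y \<bullet> (A *v (x::real^'d))"
  by (metis assms dot_lmul_matrix inner_commute vector_transpose_matrix transpose_transpose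
      transpose_matrix_vector)

lemma quad_form_polarization:
  assumes "transpose A = A"
  shows "quad_form A ((1/2) *\<^sub>R (x + y)) - quad_form A ((1/2) *\<^sub>R (x - y)) = x \<bullet> (A *v y)"
  by (simp add: quad_form_def inner_add inner_diff matrix_vector_mult_diff_distrib
        matrix_vector_right_distrib matrix_vector_mult_scaleR inner_matrix_commute[OF assms, of y x] field_simps)

lemma quad_form_le_onorm: "quad_form A x \<le> onorm ((*v) A) * (norm x)\<^sup>2"
proof -
  have "quad_form A x \<le> norm x * norm (A *v x)"
    unfolding quad_form_def by (rule norm_cauchy_schwarz)
  also have "\<dots> \<le> norm x * (onorm ((*v) A) * norm x)"
    by (intro mult_left_mono onorm) auto
  finally show ?thesis by (simp add: power2_eq_square mult_ac)
qed

lemma onorm_matrix_le: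
  fixes A :: "real^'d^'d"
  assumes "\<And>x y. norm x = 1 \<Longrightarrow> norm y = 1 \<Longrightarrow> x \<bullet> (A *v y) \<le> b" and "0 \<le> b"
  shows "onorm ((*v) A) \<le> b"
proof (rule onorm_le)
  fix y :: "real^'d"
  show "norm (A *v y) \<le> b * norm y"
  proof (cases "A *v y = 0 \<or> y = 0")
    case True
    then show ?thesis using assms(2) by auto
  next
    case False
    have "sgn (A *v y) \<bullet> (A *v sgn y) \<le> b"
      using False by (intro assms(1)) (auto simp: norm_sgn)
    moreover have "sgn (A *v y) \<bullet> (A *v sgn y) = norm (A *v y) / norm y"
      using False by (simp add: sgn_div_norm matrix_vector_mult_scaleR dot_square_norm
          power2_eq_square field_simps)
    ultimately show ?thesis using False by (simp add: field_simps)
  qed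
qed

lemma pos_semidef_quad_form_nonneg: "pos_semidef A \<Longrightarrow> 0 \<le> quad_form A x"
  by (simp add: pos_semidef_def quad_form_def)

lemma pos_semidef_Cauchy_Schwarz:
  assumes "pos_semidef A"
  shows "(x \<bullet> (A *v y))\<^sup>2 \<le> quad_form A x * quad_form A y"
proof -
  have *: "quad_form A (s *\<^sub>R x + y)
      = quad_form A x * s\<^sup>2 + 2 * (x \<bullet> (A *v y)) * s + quad_form A y" for s
    using assms inner_matrix_commute[of A y x]
    by (simp add: quad_form_def inner_add matrix_vector_right_distrib matrix_vector_mult_scaleR
        pos_semidef_def power2_eq_square algebra_simps)
  have nn: "0 \<le> quad_form A x * s\<^sup>2 + 2 * (x \<bullet> (A *v y)) * s + quad_form A y" for s
    using pos_semidef_quad_form_nonneg[OF assms] unfolding *[symmetric] .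
  show ?thesis
  proof (cases "quad_form A x = 0")
    case True
    \<comment> \<open>The polynomial \<open>nn\<close> is then affine in \<open>s\<close>, so its slope vanishes.\<close>
    have "x \<bullet> (A *v y) = 0"
    proof (rule ccontr)
      assume "x \<bullet> (A *v y) \<noteq> 0"
      then show False
        using nn[of "- (quad_form A y + 1) / (2 * (x \<bullet> (A *v y)))"] True by simp
    qed
    then show ?thesis using True by simp
  next
    case False
    then have pos: "0 < quad_form A x"
      using pos_semidef_quad_form_nonneg[OF assms, of x] by simp
    \<comment> \<open>The value of the polynomial at its minimum.\<close>
    have "0 \<le> quad_form A x * quad_form A y - (x \<bullet> (A *v y))\<^sup>2"
      using mult_left_mono[OF nn[of "- (x \<bullet> (A *v y)) / quad_form A x"], of "quad_form A x"] pos
      by (simp add: field_simps power2_eq_square)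
    then show ?thesis by simp
  qed
qed

lemma quad_form_axis: "quad_form A (axis i 1) = A $ i $ i"
  by (simp add: quad_form_def inner_axis' matrix_vector_mul_component inner_axis)

text \<open>The effective rank of a nonzero positive semi-definite matrix is thus at least 1. The proof
  uses \<open>\<bar>A\<^sub>i\<^sub>j\<bar> \<le> sqrt (A\<^sub>i\<^sub>i A\<^sub>j\<^sub>j)\<close> instead of a spectral decomposition.\<close>

lemma onorm_le_trace:
  fixes A :: "real^'d^'d"
  assumes "pos_semidef A"
  shows "onorm ((*v) A) \<le> trace A"
proof -
  define d where "d i = sqrt (A $ i $ i)" for i
  have diag: "0 \<le> A $ i $ i" for i
    using pos_semidef_quad_form_nonneg[OF assms, of "axis i 1"] by (simp add: quad_form_axis)
  have entry: "\<bar>A $ i $ j\<bar> \<le> d i * d j" for i j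
  proof -
    have "axis i 1 \<bullet> (A *v axis j 1) = A $ i $ j"
      by (simp add: inner_axis' matrix_vector_mul_component inner_axis)
    then have "(A $ i $ j)\<^sup>2 \<le> A $ i $ i * A $ j $ j"
      using pos_semidef_Cauchy_Schwarz[OF assms, of "axis i 1" "axis j 1"]
      by (simp add: quad_form_axis)
    then have "\<bar>A $ i $ j\<bar> \<le> sqrt (A $ i $ i * A $ j $ j)"
      by (metis real_sqrt_abs real_sqrt_le_mono)
    then show ?thesis by (simp add: d_def real_sqrt_mult)
  qed
  have S: "(\<Sum>i\<in>UNIV. (d i)\<^sup>2) = trace A"
    by (simp add: d_def trace_def diag)
  have cs: "(\<Sum>i\<in>UNIV. \<bar>x $ i\<bar> * d i) \<le> sqrt (trace A)" if "norm x = 1" for x :: "real^'d"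
  proof -
    have "(\<Sum>i\<in>UNIV. \<bar>x $ i\<bar> * d i)\<^sup>2 \<le> (\<Sum>i\<in>UNIV. \<bar>x $ i\<bar>\<^sup>2) * (\<Sum>i\<in>UNIV. (d i)\<^sup>2)"
      by (rule Cauchy_Schwarz_ineq_sum)
    also have "(\<Sum>i\<in>UNIV. \<bar>x $ i\<bar>\<^sup>2) = (norm x)\<^sup>2"
      by (simp only: power2_norm_eq_inner) (simp add: inner_vec_def power2_eq_square)
    finally show ?thesis using that S by (simp add: real_le_rsqrt)
  qed
  have tr: "0 \<le> trace A" by (simp add: trace_def diag sum_nonneg)
  show ?thesis
  proof (rule onorm_matrix_le[OF _ tr])
    fix x y :: "real^'d" assume xy: "norm x = 1" "norm y = 1"
    have "x \<bullet> (A *v y) = (\<Sum>i\<in>UNIV. \<Sum>j\<in>UNIV. x $ i * (A $ i $ j * y $ j))"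
      by (simp add: inner_vec_def matrix_vector_mult_def sum_distrib_left)
    also have "\<dots> \<le> (\<Sum>i\<in>UNIV. \<Sum>j\<in>UNIV. (\<bar>x $ i\<bar> * d i) * (\<bar>y $ j\<bar> * d j))"
    proof (intro sum_mono)
      fix i j
      have "x $ i * (A $ i $ j * y $ j) \<le> \<bar>x $ i\<bar> * (\<bar>A $ i $ j\<bar> * \<bar>y $ j\<bar>)"
        by (metis abs_ge_self abs_mult)
      also have "\<dots> \<le> \<bar>x $ i\<bar> * ((d i * d j) * \<bar>y $ j\<bar>)"
        by (intro mult_left_mono mult_right_mono entry) auto
      finally show "x $ i * (A $ i $ j * y $ j) \<le> (\<bar>x $ i\<bar> * d i) * (\<bar>y $ j\<bar> * d j)"
        by (simp add: mult_ac)
    qed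
    also have "\<dots> = (\<Sum>i\<in>UNIV. \<bar>x $ i\<bar> * d i) * (\<Sum>j\<in>UNIV. \<bar>y $ j\<bar> * d j)"
      by (simp add: sum_product)
    also have "\<dots> \<le> sqrt (trace A) * sqrt (trace A)"
      using xy tr by (intro mult_mono cs) (auto intro!: sum_nonneg simp: d_def diag)
    finally show "x \<bullet> (A *v y) \<le> trace A" using tr by simp
  qed
qed

lemma pos_semidef_mean:
  assumes psd: "AE \<omega> in Q. pos_semidef (M \<omega>)"
    and mean: "has_bochner_integral Q M (\<Sigma> :: real^'d^'d)"
  shows "pos_semidef \<Sigma>"
proof -
  have lin: "bounded_linear f \<Longrightarrow> has_bochner_integral Q (\<lambda>\<omega>. f (M \<omega>)) (f \<Sigma>)"
    for f :: "real^'d^'d \<Rightarrow> 'c::{second_countable_topology,banach}"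
    using has_bochner_integral_bounded_linear[OF _ mean] by blast
  have "linear (transpose :: real^'d^'d \<Rightarrow> real^'d^'d)"
    by (rule linearI) (simp_all add: transpose_def vec_eq_iff)
  then have T: "has_bochner_integral Q (\<lambda>\<omega>. transpose (M \<omega>)) (transpose \<Sigma>)"
    by (intro lin) (simp add: linear_conv_bounded_linear)
  have q: "has_bochner_integral Q (\<lambda>\<omega>. quad_form (M \<omega>) x) (quad_form \<Sigma> x)" for x
    by (intro lin) (simp add: linear_conv_bounded_linear[symmetric] linear_quad_form)
  have "transpose \<Sigma> = \<Sigma>"
  proof -
    have "(\<integral>\<omega>. transpose (M \<omega>) \<partial>Q) = (\<integral>\<omega>. M \<omega> \<partial>Q)"
      using psd T mean by (intro integral_cong_AE) (auto simp: pos_semidef_def has_bochner_integral_iff)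
    then show ?thesis
      using has_bochner_integral_integral_eq[OF T] has_bochner_integral_integral_eq[OF mean] by simp
  qed
  moreover have "0 \<le> quad_form \<Sigma> x" for x
    using psd by (subst has_bochner_integral_integral_eq[OF q, symmetric])
      (intro integral_nonneg_AE, auto simp: pos_semidef_quad_form_nonneg)
  ultimately show ?thesis by (simp add: pos_semidef_def quad_form_def)
qed

lemma closed_onorm_le: "closed {A :: real^'d^'d. onorm ((*v) A) \<le> b}"
proof (cases "0 \<le> b")
  case True
  have "{A :: real^'d^'d. onorm ((*v) A) \<le> b} = (\<Inter>x. {A. norm (A *v x) \<le> b * norm x})"
  proof (intro set_eqI iffI)
    fix A :: "real^'d^'d" assume "A \<in> {A. onorm ((*v) A) \<le> b}"
    then show "A \<in> (\<Inter>x. {A. norm (A *v x) \<le> b * norm x})"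
      by (auto intro!: order_trans[OF onorm[OF matrix_vector_mul_bounded_linear]] mult_right_mono)
  qed (auto intro: onorm_le)
  moreover have "closed {A :: real^'d^'d. norm (A *v x) \<le> b * norm x}" for x
    unfolding matrix_vector_mult_def by (intro closed_Collect_le continuous_intros)
  ultimately show ?thesis by auto
next
  case False
  then have "{A :: real^'d^'d. onorm ((*v) A) \<le> b} = {}"
    using onorm_pos_le[OF matrix_vector_mul_bounded_linear] by (auto simp: not_le intro: less_le_trans)
  then show ?thesis by simp
qed

lemma closed_symmetric_matrices: "closed {A :: real^'d^'d. transpose A = A}"
  unfolding transpose_def by (intro closed_Collect_eq continuous_intros)

section \<open>Gaussian smoothing of quadratic forms\<close>

lemma gauss_quad_form:
  fixes A :: "real^'d^'d"
  assumes "\<sigma> > 0"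
  shows "has_bochner_integral (gauss \<sigma>) (quad_form A) (\<sigma>\<^sup>2 * trace A)"
proof -
  have "has_bochner_integral (gauss \<sigma>) (\<lambda>z. (z::real^'d) $ i * z $ j) (if i = j then \<sigma>\<^sup>2 else 0)" for i j
    using gauss_second_moment[OF assms, of "axis i 1 :: real^'d" "axis j 1"]
    by (simp add: axis_in_Basis_iff inner_axis axis_eq_axis)
  then have "has_bochner_integral (gauss \<sigma>)
      (\<lambda>z::real^'d. \<Sum>i\<in>UNIV. \<Sum>j\<in>UNIV. A $ i $ j * (z $ i * z $ j))
      (\<Sum>i\<in>UNIV. \<Sum>j\<in>UNIV. A $ i $ j * (if i = j then \<sigma>\<^sup>2 else 0))"
    by (intro has_bochner_integral_sum has_bochner_integral_mult_right) auto
  moreover have "(\<Sum>i\<in>UNIV. \<Sum>j\<in>UNIV. A $ i $ j * (if i = j then \<sigma>\<^sup>2 else 0)) = \<sigma>\<^sup>2 * trace A"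
    by (simp add: trace_def sum_distrib_left mult.commute if_distrib cong: if_cong)
  ultimately show ?thesis by (simp add: quad_form_eq_sum[abs_def])
qed

lemma gauss_quad_form_le:
  fixes A :: "real^'d^'d"
  assumes "\<sigma> > 0" "pos_semidef A" "0 < b" "2 * (\<sigma>\<^sup>2 * trace A) \<le> b"
  shows "ennreal (1/2) \<le> emeasure (gauss \<sigma>) {z. quad_form A z \<le> b}"
proof -
  interpret prob_space "gauss \<sigma> :: (real^'d) measure" by (rule prob_space_gauss) fact
  note q = gauss_quad_form[OF assms(1), of A]
  have [measurable]: "{z. quad_form A z \<le> b} \<in> sets borel" by measurable
  have "prob {z \<in> space (gauss \<sigma>). b \<le> quad_form A z} \<le> (\<integral>z. quad_form A z \<partial>gauss \<sigma>) / b"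
    by (rule integral_Markov_inequality_measure[where A = "{}"])
       (use q assms in \<open>auto simp: has_bochner_integral_iff pos_semidef_quad_form_nonneg\<close>)
  also have "\<dots> \<le> 1 / 2"
    using q assms by (simp add: has_bochner_integral_iff field_simps)
  finally have half: "prob {z. b \<le> quad_form A z} \<le> 1 / 2" by simp
  have "1 - prob {z. quad_form A z \<le> b} = prob (UNIV - {z. quad_form A z \<le> b})"
    by (subst prob_compl[symmetric]) auto
  also have "\<dots> \<le> prob {z. b \<le> quad_form A z}"
    by (intro finite_measure_mono) auto
  finally have "1 / 2 \<le> prob {z. quad_form A z \<le> b}" using half by linarith
  then show ?thesis unfolding emeasure_eq_measure by (rule ennreal_leI)
qed

text \<open>Exponential integrals of \<open>\<plusminus>\<theta>\<^sup>T N \<theta>\<close> against one Gaussian measure control the operator norm of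
  \<open>N\<close>. The integrals over \<open>K\<close> left by the shifts are unknown, but with opposite signs their
  product is at least the squared measure of \<open>K\<close>.\<close>

lemma onorm_le_of_gauss_exp_integrals:
  fixes N :: "real^'d^'d"
  assumes \<sigma>: "\<sigma> > 0" and N: "transpose N = N"
    and [measurable]: "K \<in> sets borel" "S \<in> sets borel"
    and half: "ennreal (1/2) \<le> emeasure (gauss \<sigma>) K"
    and sym: "\<And>z. z \<in> K \<Longrightarrow> - z \<in> K"
    and sub: "\<And>u z. norm u \<le> 1 \<Longrightarrow> z \<in> K \<Longrightarrow> u + z \<in> S"
    and pos: "(\<integral>\<^sup>+\<theta>. ennreal (exp (quad_form N \<theta>)) * indicator S \<theta> \<partial>gauss \<sigma>) \<le> ennreal c"
    and neg: "(\<integral>\<^sup>+\<theta>. ennreal (exp (- quad_form N \<theta>)) * indicator S \<theta> \<partial>gauss \<sigma>) \<le> ennreal c"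
    and c: "1/2 \<le> c"
  shows "onorm ((*v) N) \<le> 1 / (2 * \<sigma>\<^sup>2) + 2 * ln (2 * c)"
proof (rule onorm_matrix_le)
  show "0 \<le> 1 / (2 * \<sigma>\<^sup>2) + 2 * ln (2 * c)" using c by simp
next
  fix x y :: "real^'d"
  assume xy: "norm x = 1" "norm y = 1"
  define u v where "u = (1/2) *\<^sub>R (x + y)" and "v = (1/2) *\<^sub>R (x - y)"
  have uv: "(norm u)\<^sup>2 + (norm v)\<^sup>2 = 1"
    using xy by (simp add: u_def v_def power_divide)
       (simp add: power2_norm_eq_inner norm_eq_1 inner_add inner_diff inner_commute field_simps)
  then have "(norm u)\<^sup>2 \<le> 1\<^sup>2" "(norm v)\<^sup>2 \<le> 1\<^sup>2"
    by (smt (verit) one_power2 zero_le_power2)+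
  then have nrm: "norm u \<le> 1" "norm v \<le> 1"
    using power2_le_imp_le[of "norm u" 1] power2_le_imp_le[of "norm v" 1] by simp_all
  let ?V = "\<lambda>s. \<integral>\<^sup>+z. ennreal (exp (s * quad_form N z)) * indicator K z \<partial>gauss \<sigma>"
  define a where "a = quad_form N u - (norm u)\<^sup>2 / (2 * \<sigma>\<^sup>2)"
  define b where "b = - quad_form N v - (norm v)\<^sup>2 / (2 * \<sigma>\<^sup>2)"
  have A: "ennreal (exp a) * ?V 1 \<le> ennreal c"
    unfolding a_def using gauss_shift_lower_bound[of "quad_form N" S K u \<sigma>]
    by (intro order_trans[OF _ pos]) (simp add: quad_form_parallelogram sym sub nrm)
  have V_neg: "?V (-1) = (\<integral>\<^sup>+z. ennreal (exp (- quad_form N z)) * indicator K z \<partial>gauss \<sigma>)"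
    by simp
  have par: "- quad_form N (v + z) + - quad_form N (v - z) = 2 * - quad_form N v + 2 * - quad_form N z" for z
    using quad_form_parallelogram[of N v z] by linarith
  have B: "ennreal (exp b) * ?V (-1) \<le> ennreal c"
    unfolding b_def V_neg
    by (rule order_trans[OF gauss_shift_lower_bound[where q = "\<lambda>z. - quad_form N z", OF _ _ _ par] neg])
       (auto simp: sym sub nrm)
  have "ennreal (exp a * exp b * (1/2)\<^sup>2) = ennreal (exp a) * ennreal (exp b) * (ennreal (1/2))\<^sup>2"
    by (simp add: ennreal_mult ennreal_power del: ennreal_half)
  also have "\<dots> \<le> ennreal (exp a) * ennreal (exp b) * (emeasure (gauss \<sigma>) K)\<^sup>2"
    by (intro mult_left_mono power_mono half) auto
  also have "\<dots> \<le> ennreal (exp a) * ennreal (exp b) * (?V 1 * ?V (-1))"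
    using emeasure_square_le_exp_integrals[of "quad_form N" "gauss \<sigma>" K]
    by (intro mult_left_mono) auto
  also have "\<dots> = (ennreal (exp a) * ?V 1) * (ennreal (exp b) * ?V (-1))"
    by (simp only: mult_ac)
  also have "\<dots> \<le> ennreal c * ennreal c"
    by (intro mult_mono A B) auto
  also have "\<dots> = ennreal (c * c)" using c by (simp add: ennreal_mult)
  finally have "exp a * exp b * (1/2)\<^sup>2 \<le> c * c"
    using c by (subst (asm) ennreal_le_iff) auto
  then have "exp (a + b) \<le> (2 * c)\<^sup>2" by (simp add: exp_add power2_eq_square)
  then have "ln (exp (a + b)) \<le> ln ((2 * c)\<^sup>2)"
    using c by (subst ln_le_cancel_iff) auto
  then have "a + b \<le> 2 * ln (2 * c)"
    using c by (subst (asm) ln_realpow) auto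
  moreover have "a + b = quad_form N u - quad_form N v - ((norm u)\<^sup>2 + (norm v)\<^sup>2) / (2 * \<sigma>\<^sup>2)"
    by (simp add: a_def b_def add_divide_distrib)
  moreover have "quad_form N u - quad_form N v = x \<bullet> (N *v y)"
    unfolding u_def v_def by (rule quad_form_polarization[OF N])
  ultimately show "x \<bullet> (N *v y) \<le> 1 / (2 * \<sigma>\<^sup>2) + 2 * ln (2 * c)"
    by (simp add: uv)
qed

section \<open>Deviation of the sample mean\<close>

lemma ln_4_le: "ln (4::real) \<le> 2"
  using ln_le_minus_one[of "2::real"] ln_mult[of 2 "2::real"] by simp

theorem theorem1:
  fixes P :: "'a measure" and Q :: "'b measure"
    and M :: "'b \<Rightarrow> real^'d^'d"
    and X :: "nat \<Rightarrow> 'a \<Rightarrow> real^'d^'d"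
    and \<Sigma> :: "real^'d^'d"
    and n :: nat and \<kappa> t :: real
  assumes "prob_space P" and "prob_space Q"
    and psd: "AE \<omega> in Q. pos_semidef (M \<omega>)"
    and mean: "has_bochner_integral Q M \<Sigma>"
    and nonzero: "\<Sigma> \<noteq> 0"
    and indep: "prob_space.indep_vars P (\<lambda>_. borel) X {1..n}"
    and copies: "\<And>i. i \<in> {1..n} \<Longrightarrow> distr P borel (X i) = distr Q borel M"
    and kappa: "\<kappa> \<ge> 1"
    and subexp: "\<And>x :: real^'d.
      psi_norm 1 Q (\<lambda>\<omega>. x \<bullet> (M \<omega> *v x)) \<le> ennreal (\<kappa>\<^sup>2 * (x \<bullet> (\<Sigma> *v x)))"
    and t: "t > 0"
    and n: "real n \<ge> 4 * effective_rank \<Sigma> + t"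
  shows "measure P {\<omega> \<in> space P.
      onorm ((*v) ((1 / real n) *\<^sub>R (\<Sum>i=1..n. X i \<omega>) - \<Sigma>))
        \<le> 20 * \<kappa>\<^sup>2 * onorm ((*v) \<Sigma>) * sqrt ((4 * effective_rank \<Sigma> + t) / real n)}
    \<ge> 1 - exp (- t)"
proof -
  interpret P: prob_space P by fact
  interpret Q: prob_space Q by fact
  have \<Sigma>: "pos_semidef \<Sigma>" using pos_semidef_mean[OF psd mean] .
  have [measurable]: "M \<in> borel_measurable Q" using mean by (auto simp: has_bochner_integral_iff)
  have X [measurable]: "X i \<in> borel_measurable P" if "i \<in> {1..n}" for i
    using indep that by (auto simp: P.indep_vars_def2)
  define r where "r = effective_rank \<Sigma>"
  define L where "L = onorm ((*v) \<Sigma>)"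
  have L: "0 < L"
    unfolding L_def using nonzero
    by (subst onorm_pos_lt[OF matrix_vector_mul_bounded_linear])
       (metis matrix_eq matrix_vector_mult_0)
  have rL: "trace \<Sigma> = r * L" and r: "1 \<le> r"
    using L onorm_le_trace[OF \<Sigma>] by (simp_all add: r_def effective_rank_def flip: L_def)
  define D where "D = (4 * r + t) / real n"
  define K where "K = 4 * \<kappa>\<^sup>2 * L"
  \<comment> \<open>\<open>K\<close> strictly exceeds the \<open>\<psi>\<^sub>1\<close> norm bound \<open>5/2 * \<kappa>\<^sup>2 * L\<close> on \<open>S\<close> below; \<open>l\<close> makes the
    exponential moment bound of each summand equal to \<open>exp D\<close>, and the assumption on \<open>n\<close> is
    what gives \<open>l * K \<le> 1\<close>.\<close>
  define l where "l = sqrt D / K"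
  have npos: "0 < real n" using n r t by (simp add: r_def)
  have D: "0 < D" "D \<le> 1" and nD: "real n * D = 4 * r + t"
    using n npos r t by (auto simp: D_def r_def)
  have K: "0 < K" using kappa L by (simp add: K_def)
  have l: "0 < l" and lK: "l * K = sqrt D" using D K by (simp_all add: l_def)
  define \<sigma> where "\<sigma> = sqrt (1 / (8 * r))"
  have \<sigma>: "0 < \<sigma>" and \<sigma>2: "\<sigma>\<^sup>2 = 1 / (8 * r)" using r by (simp_all add: \<sigma>_def)
  \<comment> \<open>The constant \<open>5/2 = 2 * (1 + 1/4)\<close> is what the parallelogram identity gives for the sum of a
    vector of norm at most 1 and an element of \<open>Z\<close>.\<close>
  define S where "S = {\<theta>. quad_form \<Sigma> \<theta> \<le> 5/2 * L}"
  define Z where "Z = {z. quad_form \<Sigma> z \<le> L / 4}"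
  have [measurable]: "S \<in> sets borel" "Z \<in> sets borel" unfolding S_def Z_def by measurable
  have half: "ennreal (1/2) \<le> emeasure (gauss \<sigma>) Z"
    unfolding Z_def using \<sigma> \<Sigma> L r by (intro gauss_quad_form_le) (auto simp: \<sigma>2 rL)
  have Z_sym: "- z \<in> Z" if "z \<in> Z" for z using that by (simp add: Z_def)
  have ZS: "u + z \<in> S" if "norm u \<le> 1" "z \<in> Z" for u z
  proof -
    have "(norm u)\<^sup>2 \<le> 1" using that(1) by (simp add: power_le_one)
    then have "L * (norm u)\<^sup>2 \<le> L" using L by simp
    with quad_form_le_onorm[of \<Sigma> u] have "quad_form \<Sigma> u \<le> L" unfolding L_def by linarith
    with quad_form_parallelogram[of \<Sigma> u z] pos_semidef_quad_form_nonneg[OF \<Sigma>, of "u - z"] that(2)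
    show ?thesis by (simp add: S_def Z_def)
  qed
  have one: "(\<integral>\<^sup>+\<omega>. ennreal (exp (s * l * quad_form (X i \<omega> - \<Sigma>) \<theta>)) \<partial>P) \<le> ennreal (exp D)"
    if i: "i \<in> {1..n}" and \<theta>: "\<theta> \<in> S" and s: "\<bar>s\<bar> = 1" for s i \<theta>
  proof -
    have "bounded_linear (\<lambda>A. quad_form A \<theta>)"
      by (simp add: linear_conv_bounded_linear[symmetric] linear_quad_form)
    then have "has_bochner_integral Q (\<lambda>\<omega>. quad_form (M \<omega>) \<theta>) (quad_form \<Sigma> \<theta>)"
      using has_bochner_integral_bounded_linear[OF _ mean] by blast
    moreover have "psi_norm 1 Q (\<lambda>\<omega>. quad_form (M \<omega>) \<theta>) < ennreal K"
    proof (rule le_less_trans)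
      show "psi_norm 1 Q (\<lambda>\<omega>. quad_form (M \<omega>) \<theta>) \<le> ennreal (\<kappa>\<^sup>2 * quad_form \<Sigma> \<theta>)"
        using subexp[of \<theta>] by (simp add: quad_form_def)
      have "\<kappa>\<^sup>2 * quad_form \<Sigma> \<theta> \<le> \<kappa>\<^sup>2 * (5/2 * L)"
        using \<theta> by (intro mult_left_mono) (auto simp: S_def)
      also have "\<dots> < K" using L kappa by (simp add: K_def)
      finally show "ennreal (\<kappa>\<^sup>2 * quad_form \<Sigma> \<theta>) < ennreal K"
        using K by (simp add: ennreal_lessI)
    qed
    moreover have "\<bar>s * l\<bar> * K \<le> 1"
      using s l lK D by (simp add: abs_mult)
    ultimately have "(\<integral>\<^sup>+\<omega>. ennreal (exp (s * l * (quad_form (M \<omega>) \<theta> - quad_form \<Sigma> \<theta>))) \<partial>Q)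
        \<le> ennreal (exp ((s * l * K)\<^sup>2))"
      by (rule Q.mgf_le_of_psi_norm_less)
    also have "(s * l * K)\<^sup>2 = D"
      using s lK D power2_abs[of s] by (simp add: mult.assoc power_mult_distrib)
    finally have MQ: "(\<integral>\<^sup>+\<omega>. ennreal (exp (s * l * quad_form (M \<omega> - \<Sigma>) \<theta>)) \<partial>Q) \<le> ennreal (exp D)"
      by (simp add: quad_form_diff)
    let ?f = "\<lambda>A. ennreal (exp (s * l * quad_form (A - \<Sigma>) \<theta>))"
    have "(\<integral>\<^sup>+\<omega>. ?f (X i \<omega>) \<partial>P) = (\<integral>\<^sup>+A. ?f A \<partial>distr P borel (X i))"
      using i by (subst nn_integral_distr) auto
    also have "\<dots> = (\<integral>\<^sup>+\<omega>. ?f (M \<omega>) \<partial>Q)"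
      unfolding copies[OF i] by (subst nn_integral_distr) auto
    finally show ?thesis using MQ by simp
  qed
  define N where "N \<omega> = l *\<^sub>R (\<Sum>i=1..n. X i \<omega> - \<Sigma>)" for \<omega>
  have [measurable]: "N \<in> borel_measurable P" unfolding N_def by measurable
  define W where "W s \<omega> = (\<integral>\<^sup>+\<theta>. ennreal (exp (s * quad_form (N \<omega>) \<theta>)) * indicator S \<theta> \<partial>gauss \<sigma>)"
    for s \<omega>
  interpret G: prob_space "gauss \<sigma> :: (real^'d) measure" using \<sigma> by (rule prob_space_gauss)
  interpret PG: pair_sigma_finite P "gauss \<sigma> :: (real^'d) measure" ..
  have [measurable]: "W s \<in> borel_measurable P" for s unfolding W_def by measurable
  have EW: "(\<integral>\<^sup>+\<omega>. W s \<omega> \<partial>P) \<le> ennreal (exp (n * D))" if s: "\<bar>s\<bar> = 1" for s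
  proof -
    have "(\<integral>\<^sup>+\<omega>. W s \<omega> \<partial>P)
      = (\<integral>\<^sup>+\<theta>. \<integral>\<^sup>+\<omega>. ennreal (exp (s * quad_form (N \<omega>) \<theta>)) * indicator S \<theta> \<partial>P \<partial>gauss \<sigma>)"
      unfolding W_def by (rule PG.Fubini'[symmetric]) measurable
    also have "\<dots> \<le> (\<integral>\<^sup>+\<theta>. ennreal (exp (n * D)) \<partial>(gauss \<sigma> :: (real^'d) measure))"
    proof (rule nn_integral_mono)
      fix \<theta> :: "real^'d"
      show "(\<integral>\<^sup>+\<omega>. ennreal (exp (s * quad_form (N \<omega>) \<theta>)) * indicator S \<theta> \<partial>P) \<le> ennreal (exp (n * D))"
      proof (cases "\<theta> \<in> S")
        case True
        have "(\<integral>\<^sup>+\<omega>. ennreal (exp (\<Sum>i\<in>{1..n}. s * l * quad_form (X i \<omega> - \<Sigma>) \<theta>)) \<partial>P)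
            \<le> ennreal (exp (card {1..n} * D))"
          by (rule P.nn_integral_exp_sum_indep_le[OF _ indep,
                where f = "\<lambda>A. s * l * quad_form (A - \<Sigma>) \<theta>"]) (auto intro: one[OF _ True s])
        then show ?thesis
          using True by (simp add: N_def quad_form_scaleR quad_form_sum sum_distrib_left mult.assoc)
      qed simp
    qed
    also have "\<dots> = ennreal (exp (n * D))"
      by (simp add: G.emeasure_space_1[simplified])
    finally show ?thesis .
  qed
  define c where "c = 2 * exp (n * D + t)"
  \<comment> \<open>The complement of \<open>Bad\<close> bounds both exponential integrals by \<open>c\<close>, since \<open>W\<close> is nonnegative.\<close>
  define Bad where "Bad = {\<omega> \<in> space P. 1 \<le> ennreal (1 / c) * (W 1 \<omega> + W (-1) \<omega>)}"
  have [measurable]: "Bad \<in> sets P" unfolding Bad_def by measurable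
  have cpos: "0 < c" by (simp add: c_def)
  have "emeasure P Bad \<le> ennreal (1 / c) * (\<integral>\<^sup>+\<omega>. (W 1 \<omega> + W (-1) \<omega>) * indicator (space P) \<omega> \<partial>P)"
    unfolding Bad_def by (rule nn_integral_Markov_inequality) auto
  also have "(\<integral>\<^sup>+\<omega>. (W 1 \<omega> + W (-1) \<omega>) * indicator (space P) \<omega> \<partial>P) = (\<integral>\<^sup>+\<omega>. W 1 \<omega> + W (-1) \<omega> \<partial>P)"
    by (intro nn_integral_cong) auto
  also have "\<dots> = (\<integral>\<^sup>+\<omega>. W 1 \<omega> \<partial>P) + (\<integral>\<^sup>+\<omega>. W (-1) \<omega> \<partial>P)"
    by (rule nn_integral_add) auto
  also have "ennreal (1 / c) * \<dots> \<le> ennreal (1 / c) * (ennreal (exp (n * D)) + ennreal (exp (n * D)))"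
    by (intro mult_left_mono add_mono EW) auto
  also have "\<dots> = ennreal (1 / c * (exp (n * D) + exp (n * D)))"
    using cpos by (simp flip: ennreal_plus ennreal_mult)
  also have "1 / c * (exp (n * D) + exp (n * D)) = exp (- t)"
    by (simp add: c_def exp_add exp_minus field_simps)
  finally have bad: "P.prob Bad \<le> exp (- t)" by (simp add: P.emeasure_eq_measure)
  define B where "B = 20 * \<kappa>\<^sup>2 * L * sqrt D"
  define dev where "dev \<omega> = (1 / real n) *\<^sub>R (\<Sum>i=1..n. X i \<omega>) - \<Sigma>" for \<omega>
  have [measurable]: "dev \<in> borel_measurable P" unfolding dev_def by measurable
  have good: "onorm ((*v) (dev \<omega>)) \<le> B"
    if \<omega>: "\<omega> \<in> space P" "\<omega> \<notin> Bad" and sym: "\<forall>i\<in>{1..n}. transpose (X i \<omega>) = X i \<omega>" for \<omega>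
  proof -
    have "W 1 \<omega> + W (-1) \<omega> \<le> ennreal c"
    proof (rule ccontr)
      assume "\<not> ?thesis"
      then have "ennreal (1 / c) * ennreal c \<le> ennreal (1 / c) * (W 1 \<omega> + W (-1) \<omega>)"
        by (intro mult_left_mono) auto
      then show False using \<omega> cpos by (simp add: Bad_def flip: ennreal_mult)
    qed
    then have W: "W 1 \<omega> \<le> ennreal c" "W (-1) \<omega> \<le> ennreal c"
      by (auto intro: order_trans[rotated])
    have "transpose (\<Sum>i=1..n. X i \<omega> - \<Sigma>) = (\<Sum>i=1..n. X i \<omega> - \<Sigma>)"
      using sym \<Sigma> unfolding pos_semidef_def
      by (simp add: vec_eq_iff transpose_def)
    then have "transpose (N \<omega>) = N \<omega>"
      by (simp add: N_def transpose_scalar)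
    then have "onorm ((*v) (N \<omega>)) \<le> 1 / (2 * \<sigma>\<^sup>2) + 2 * ln (2 * c)"
    proof (rule onorm_le_of_gauss_exp_integrals[OF \<sigma> _ _ _ half Z_sym ZS])
      have "1 \<le> exp (n * D + t)" using D t by simp
      then show "1/2 \<le> c" unfolding c_def by linarith
    qed (use W in \<open>auto simp: W_def\<close>)
    also have "1 / (2 * \<sigma>\<^sup>2) = 4 * r" using r by (simp add: \<sigma>2)
    also have "ln (2 * c) = ln 4 + (n * D + t)"
      by (simp add: c_def ln_mult)
    \<comment> \<open>The additive constant \<open>2 * ln 4 \<le> 4\<close> is absorbed by \<open>4 * r\<close>, as \<open>r \<ge> 1\<close>.\<close>
    also have "4 * r + 2 * (ln 4 + (n * D + t)) \<le> 4 * (n * D)"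
      using ln_4_le r nD by simp
    finally have N4: "onorm ((*v) (N \<omega>)) \<le> 4 * (n * D)" by simp
    have "N \<omega> = (l * n) *\<^sub>R dev \<omega>"
      using npos by (simp add: N_def dev_def sum_subtractf sum_constant_scaleR scaleR_diff_right
          del: sum_constant)
    then have "(\<lambda>x. N \<omega> *v x) = (\<lambda>x. (l * n) *\<^sub>R (dev \<omega> *v x))"
      by (simp add: scaleR_matrix_vector_assoc)
    then have "onorm ((*v) (N \<omega>)) = l * n * onorm ((*v) (dev \<omega>))"
      using l npos by (simp add: onorm_scaleR[OF matrix_vector_mul_bounded_linear])
    with N4 l npos have "onorm ((*v) (dev \<omega>)) \<le> 4 * D / l"
      by (simp add: field_simps)
    also have "4 * D / l = 4 * K * sqrt D"
      using D K by (simp add: l_def field_simps flip: real_sqrt_mult)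
    \<comment> \<open>The left-hand side is \<open>16 * \<kappa>\<^sup>2 * L * sqrt D\<close>.\<close>
    also have "\<dots> \<le> B" using L D by (simp add: K_def B_def mult_right_mono)
    finally show ?thesis .
  qed
  \<comment> \<open>Symmetry is only known almost surely, and for \<open>X i\<close> only through the law of \<open>M\<close>.\<close>
  have "AE \<omega> in P. \<forall>i\<in>{1..n}. transpose (X i \<omega>) = X i \<omega>"
  proof (rule AE_finite_allI)
    fix i assume i: "i \<in> {1..n}"
    have [measurable]: "{A :: real^'d^'d. transpose A = A} \<in> sets borel"
      by (intro borel_closed closed_symmetric_matrices)
    have "AE A in distr Q borel M. transpose A = A"
      using psd by (subst AE_distr_iff) (auto simp: pos_semidef_def)
    then show "AE \<omega> in P. transpose (X i \<omega>) = X i \<omega>"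
      unfolding copies[OF i, symmetric] using i by (subst (asm) AE_distr_iff) auto
  qed simp
  moreover have [measurable]: "{\<omega> \<in> space P. onorm ((*v) (dev \<omega>)) \<le> B} \<in> sets P"
    using measurable_sets[OF \<open>dev \<in> borel_measurable P\<close> borel_closed[OF closed_onorm_le[of B]]]
    by (simp add: vimage_def Int_def conj_commute)
  ultimately have "P.prob (space P - Bad) \<le> P.prob {\<omega> \<in> space P. onorm ((*v) (dev \<omega>)) \<le> B}"
    by (intro P.finite_measure_mono_AE) (auto elim!: AE_mp simp: good)
  moreover have "1 - exp (- t) \<le> P.prob (space P - Bad)"
    using bad by (subst P.prob_compl) auto
  ultimately show ?thesis
    unfolding dev_def B_def D_def r_def L_def by simp
qed

end
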